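(* There exists an absolute constant $c>0$ such that the following holds. Let $q$ be a prime, $F=\mathbb{Z}/q\mathbb{Z}$, and let $A$ be a nonempty subset of $F$ with $|A|<|F|^{1/2}$. Then $$|A-A|\cdot|I(A)|\ge c|A|^{5/2}.$$
   Context: For $A\subset F$, $A-A:=\{a-b:a,b\in A\}$ and $$I(A):=\{a_1(a_2-a_3)+a_4(a_5-a_6):a_1,\dots,a_6\in A\}.$$ *)

theory Defs
  imports Complex_Main "HOL-Number_Theory.Residues"
begin

definition difference_set :: "('a, 'b) ring_scheme \<Rightarrow> 'a set \<Rightarrow> 'a set" where
  "difference_set R A = {a \<ominus>\<^bsub>R\<^esub> b |a b. a \<in> A \<and> b \<in> A}"

definition I_set :: "('a, 'b) ring_scheme \<Rightarrow> 'a set \<Rightarrow> 'a set" where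
  "I_set R A =
    {a\<^sub>1 \<otimes>\<^bsub>R\<^esub> (a\<^sub>2 \<ominus>\<^bsub>R\<^esub> a\<^sub>3) \<oplus>\<^bsub>R\<^esub> a\<^sub>4 \<otimes>\<^bsub>R\<^esub> (a\<^sub>5 \<ominus>\<^bsub>R\<^esub> a\<^sub>6) |a\<^sub>1 a\<^sub>2 a\<^sub>3 a\<^sub>4 a\<^sub>5 a\<^sub>6.
      a\<^sub>1 \<in> A \<and> a\<^sub>2 \<in> A \<and> a\<^sub>3 \<in> A \<and> a\<^sub>4 \<in> A \<and> a\<^sub>5 \<in> A \<and> a\<^sub>6 \<in> A}"

end

theory Submission
  imports Defs "HOL-Analysis.Convex"
begin

text \<open>
  Let \<open>Q\<close> be the set of quotients of differences of \<open>A\<close>. If \<open>\<xi> = (a - b) / (c - d)\<close> lies in \<open>Q\<close>, then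
  multiplication by \<open>c - d\<close> embeds \<open>A + \<xi>A\<close> into \<open>I(A)\<close>. If \<open>Q = F\<close>, averaging the number of
  collisions of \<open>(a, b) \<mapsto> a + \<xi>b\<close> over all \<open>\<xi>\<close> gives \<open>\<xi>\<close> with \<open>2 |A + \<xi>A| \<ge> |A|\<^sup>2\<close>.

  Otherwise, since \<open>F\<close> is generated by \<open>1\<close>, there is \<open>\<xi> \<in> Q\<close> with \<open>\<xi> - 1 \<notin> Q\<close>, so that
  \<open>(a, b) \<mapsto> a + \<xi>b - b\<close> is injective on \<open>A \<times> A\<close>. Choose \<open>X \<subseteq> A\<close> nonempty minimizing
  \<open>|X + \<xi>A| / |X|\<close>. Petridis' argument for the inequality of Pluennecke gives
  \<open>|X| |A|\<^sup>2 \<le> |X + \<xi>A - A| |A| \<le> |A + \<xi>A| |X - A|\<close>, and minimality gives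
  \<open>|A|\<^sup>2 \<le> |X + \<xi>A| |A| \<le> |A + \<xi>A| |X|\<close>. Multiplying the two and using \<open>|A| \<le> |A - A|\<close>
  eliminates \<open>|X|\<close>.
\<close>

section \<open>Counting collisions\<close>

text \<open>Cauchy-Schwarz over the fibres of \<open>f\<close>: their sizes add up to
  \<open>card P\<close>, and the squares of their sizes add up to the number of collisions.\<close>

lemma card_squared_le_card_image_mult_collisions:
  assumes P: "finite P"
  shows "(card P)\<^sup>2 \<le> card (f ` P) * card {(x, y) \<in> P \<times> P. f x = f y}"
proof -
  let ?fib = "\<lambda>s. {x \<in> P. f x = s}"
  have "card P = (\<Sum>s\<in>f ` P. card (?fib s))"
    using sum.image_gen[OF P, of "\<lambda>_. 1::nat" f] by simp
  moreover have "real ((\<Sum>s\<in>f ` P. card (?fib s))\<^sup>2)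
      \<le> real (card (f ` P) * (\<Sum>s\<in>f ` P. (card (?fib s))\<^sup>2))"
    using sum_squared_le_sum_of_squares[of "\<lambda>s. real (card (?fib s))" "f ` P"] P
    by (simp add: mult.commute)
  moreover have "(\<Sum>s\<in>f ` P. (card (?fib s))\<^sup>2) = card (\<Union>s\<in>f ` P. ?fib s \<times> ?fib s)"
    by (subst card_UN_disjoint) (use P in \<open>auto simp: power2_eq_square\<close>)
  moreover have "(\<Union>s\<in>f ` P. ?fib s \<times> ?fib s) = {(x, y) \<in> P \<times> P. f x = f y}"
    by auto
  ultimately show ?thesis by (simp only: of_nat_le_iff)
qed

section \<open>Petridis' form of the Pluennecke inequality in an abelian group\<close>

context comm_group
begin

lemma finite_set_mult: "finite X \<Longrightarrow> finite Y \<Longrightarrow> finite (X <#> Y)"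
  by (simp add: set_mult_def)

text \<open>Induction on \<open>C\<close>, one new element \<open>c\<close> at a time. Passing to
  \<open>insert c C\<close> adds at most |XB| - |YB| products on the left and at least |X| - |Y|
  products to XC, where \<open>Y\<close> collects the x whose translate x B c is already covered.
  Minimality, applied to \<open>Y\<close>, compares these two increments.\<close>

lemma card_set_mult_of_minimal_ratio:
  assumes X: "finite X" "X \<subseteq> carrier G"
    and B: "finite B" "B \<subseteq> carrier G"
    and minimal: "\<And>Y. Y \<subseteq> X \<Longrightarrow> card (X <#> B) * card Y \<le> card (Y <#> B) * card X"
    and C: "finite C" "C \<subseteq> carrier G"
  shows "card (X <#> B <#> C) * card X \<le> card (X <#> B) * card (X <#> C)"
  using C
proof (induction C rule: finite_induct)
  case empty
  then show ?case by (simp add: set_mult_def)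
next
  case (insert c C)
  then have c: "c \<in> carrier G" and C: "finite C" "C \<subseteq> carrier G" by auto
  define S where "S = X <#> B <#> C"
  define T where "T = X <#> C"
  define Y where "Y = {x \<in> X. \<forall>b\<in>B. x \<otimes> b \<otimes> c \<in> S}"
  define Z where "Z = {x \<in> X. x \<otimes> c \<in> T}"
  have fin: "finite S" "finite T" "finite (X <#> B)" "finite Y" "finite Z" "finite (Y <#> B)"
    using X B C by (auto simp: S_def T_def Y_def Z_def intro!: finite_set_mult)
  \<comment> \<open>If x c = y d with d in \<open>C\<close>, commutativity gives x b c = y b d for
    every b, so all of x B c is old.\<close>
  have "Z \<subseteq> Y"
  proof
    fix x assume "x \<in> Z"
    then obtain y d where x: "x \<in> X" "y \<in> X" "d \<in> C" "x \<otimes> c = y \<otimes> d"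
      by (auto simp: Z_def T_def set_mult_def)
    have "x \<otimes> b \<otimes> c = y \<otimes> b \<otimes> d" if "b \<in> B" for b
    proof -
      have mem: "x \<in> carrier G" "y \<in> carrier G" "d \<in> carrier G" "b \<in> carrier G"
        using x X B C that by auto
      have "x \<otimes> b \<otimes> c = (x \<otimes> c) \<otimes> b" using mem c by (simp add: m_ac)
      also have "\<dots> = y \<otimes> b \<otimes> d" unfolding x(4) using mem by (simp add: m_ac)
      finally show ?thesis .
    qed
    with x show "x \<in> Y"
      by (auto simp: Y_def S_def set_mult_def)
  qed
  \<comment> \<open>Only products v c with v outside YB can be new.\<close>
  have "X <#> B <#> insert c C \<subseteq> S \<union> (\<lambda>u. u \<otimes> c) ` ((X <#> B) - (Y <#> B))"
  proof
    fix u assume "u \<in> X <#> B <#> insert c C"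
    then obtain v e where u: "v \<in> X <#> B" "e \<in> insert c C" "u = v \<otimes> e"
      by (auto simp: set_mult_def[of _ "X <#> B"])
    show "u \<in> S \<union> (\<lambda>u. u \<otimes> c) ` ((X <#> B) - (Y <#> B))"
    proof (cases "e \<in> C \<or> v \<in> Y <#> B")
      case True
      then have "u \<in> S"
      proof
        assume "e \<in> C"
        with u show ?thesis by (auto simp: S_def set_mult_def[of _ "X <#> B"])
      next
        assume "v \<in> Y <#> B"
        then have "v \<otimes> c \<in> S" by (auto simp: set_mult_def Y_def)
        moreover have "v \<otimes> e \<in> S" if "e \<in> C"
          using u that by (auto simp: S_def set_mult_def[of _ "X <#> B"])
        ultimately show ?thesis using u by auto
      qed
      then show ?thesis ..
    next
      case False
      with u show ?thesis by auto
    qed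
  qed
  then have "card (X <#> B <#> insert c C) \<le> card S + card ((X <#> B) - (Y <#> B))"
    by (meson add_left_mono card_Un_le card_image_le card_mono fin(1,3) finite_Diff
        finite_UnI finite_imageI order_trans)
  moreover have "card ((X <#> B) - (Y <#> B)) + card (Y <#> B) = card (X <#> B)"
    using fin mono_set_mult[of Y X B B] Y_def
    by (metis (no_types, lifting) card_Diff_subset card_mono le_add_diff_inverse2 mem_Collect_eq
        order_refl subsetI)
  ultimately have upper:
    "card (X <#> B <#> insert c C) + card (Y <#> B) \<le> card S + card (X <#> B)"
    by linarith
  \<comment> \<open>By the choice of \<open>Z\<close>, each x in \<open>X - Z\<close> gives an
    element x c of X(insert c C) outside \<open>T\<close>; these are distinct by
    cancellation.\<close>
  have "inj_on (\<lambda>x. x \<otimes> c) (X - Z)"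
    by (rule inj_onI) (use X c in \<open>auto simp: subset_iff\<close>)
  moreover have "T \<inter> (\<lambda>x. x \<otimes> c) ` (X - Z) = {}"
    by (auto simp: Z_def)
  moreover have "T \<union> (\<lambda>x. x \<otimes> c) ` (X - Z) \<subseteq> X <#> insert c C"
    by (auto simp: T_def set_mult_def)
  ultimately have "card T + card (X - Z) \<le> card (X <#> insert c C)"
    using fin X C
    by (metis card_Un_disjoint card_image card_mono finite_Diff finite_imageI finite_insert
        finite_set_mult)
  moreover have "card X \<le> card (X - Z) + card Y"
    using card_mono[OF fin(4) \<open>Z \<subseteq> Y\<close>] diff_card_le_card_Diff[OF fin(5), of X] by linarith
  ultimately have lower: "card T + card X \<le> card (X <#> insert c C) + card Y"
    by linarith
  have "card (X <#> B <#> insert c C) * card X + card (Y <#> B) * card X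
      \<le> card S * card X + card (X <#> B) * card X"
    using mult_right_mono[OF upper, of "card X"] by (simp add: algebra_simps)
  also have "\<dots> \<le> card (X <#> B) * card T + card (X <#> B) * card X"
    using insert.IH C by (simp add: S_def T_def)
  also have "\<dots> \<le> card (X <#> B) * card (X <#> insert c C) + card (X <#> B) * card Y"
    using mult_left_mono[OF lower, of "card (X <#> B)"] by (simp add: algebra_simps)
  also have "\<dots> \<le> card (X <#> B) * card (X <#> insert c C) + card (Y <#> B) * card X"
    using minimal[of Y] by (auto simp: Y_def)
  finally show ?case by simp
qed

text \<open>A minimizer of |XB| / |X| over the nonempty subsets of \<open>A\<close> also satisfies
  the minimality condition among its own subsets, so Petridis' lemma applies to it. Comparison with
  \<open>A\<close> itself then replaces |XB| / |X| by |AB| / |A|.\<close>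

lemma pluennecke_subset:
  assumes A: "finite A" "A \<noteq> {}" "A \<subseteq> carrier G"
    and B: "finite B" "B \<subseteq> carrier G"
  obtains X where "X \<subseteq> A" "X \<noteq> {}"
    "card (X <#> B) * card A \<le> card (A <#> B) * card X"
    "\<And>C. \<lbrakk>finite C; C \<subseteq> carrier G\<rbrakk> \<Longrightarrow>
      card (X <#> B <#> C) * card A \<le> card (A <#> B) * card (X <#> C)"
proof -
  let ?r = "\<lambda>X. real (card (X <#> B)) / card X"
  \<comment> \<open>The empty set must be left out: its ratio is 0 / 0 = 0, and it would be the
    minimizer.\<close>
  have "finite (Pow A - {{}})" "Pow A - {{}} \<noteq> {}" using A by auto
  note arg_min_if_finite(1)[OF this, of ?r] arg_min_least[OF this, of _ ?r]
  then obtain X where "X \<in> Pow A - {{}}" "\<And>Y. Y \<in> Pow A - {{}} \<Longrightarrow> ?r X \<le> ?r Y"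
    by blast
  then have X: "X \<subseteq> A" "X \<noteq> {}"
    and min: "\<And>Y. Y \<subseteq> A \<Longrightarrow> Y \<noteq> {} \<Longrightarrow> ?r X \<le> ?r Y" by auto
  have pos: "card Y > 0" if "Y \<subseteq> A" "Y \<noteq> {}" for Y
    using that A by (metis card_gt_0_iff finite_subset)
  have minimal: "card (X <#> B) * card Y \<le> card (Y <#> B) * card X" if "Y \<subseteq> A" for Y
  proof (cases "Y = {}")
    case False
    from min[OF that False] have "real (card (X <#> B) * card Y) \<le> real (card (Y <#> B) * card X)"
      using pos[OF that False] pos[OF X] by (simp add: field_simps)
    then show ?thesis by (simp only: of_nat_le_iff)
  qed simp
  have "card (X <#> B <#> C) * card A \<le> card (A <#> B) * card (X <#> C)"
    if C: "finite C" "C \<subseteq> carrier G" for C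
  proof -
    have "card (X <#> B <#> C) * card X \<le> card (X <#> B) * card (X <#> C)"
    proof (rule card_set_mult_of_minimal_ratio)
      show "finite X" using A(1) X(1) by (rule finite_subset[rotated])
      show "card (X <#> B) * card Y \<le> card (Y <#> B) * card X" if "Y \<subseteq> X" for Y
        using minimal that X by blast
    qed (use A B C X in auto)
    then have "card (X <#> B <#> C) * card A * card X \<le> card (X <#> B) * card A * card (X <#> C)"
      using mult_right_mono[of "card (X <#> B <#> C) * card X" _ "card A"] by (simp add: ac_simps)
    also have "\<dots> \<le> card (A <#> B) * card X * card (X <#> C)"
      using mult_right_mono[OF minimal[OF order_refl], of "card (X <#> C)"] by simp
    finally show ?thesis using pos[OF X] by (simp add: ac_simps)
  qed
  with X minimal that show ?thesis by blast
qed

end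

section \<open>Quotients of differences and dilated sums in a field\<close>

text \<open>The set Q of the overview, with the denominator cleared so that no inverse has to be
  handled.\<close>

definition ratio_set :: "('a, 'b) ring_scheme \<Rightarrow> 'a set \<Rightarrow> 'a set" where
  "ratio_set R A = {\<xi> \<in> carrier R. \<exists>a\<in>A. \<exists>b\<in>A. \<exists>c\<in>A. \<exists>d\<in>A.
    c \<noteq> d \<and> \<xi> \<otimes>\<^bsub>R\<^esub> (c \<ominus>\<^bsub>R\<^esub> d) = a \<ominus>\<^bsub>R\<^esub> b}"

definition dilate_sum :: "('a, 'b) ring_scheme \<Rightarrow> 'a \<Rightarrow> 'a set \<Rightarrow> 'a set" where
  "dilate_sum R \<xi> A = (\<lambda>(a, b). a \<oplus>\<^bsub>R\<^esub> \<xi> \<otimes>\<^bsub>R\<^esub> b) ` (A \<times> A)"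

lemma finite_difference_set: "finite A \<Longrightarrow> finite (difference_set R A)"
proof -
  have "difference_set R A = (\<lambda>(a, b). a \<ominus>\<^bsub>R\<^esub> b) ` (A \<times> A)"
    by (auto simp: difference_set_def)
  then show "finite A \<Longrightarrow> finite (difference_set R A)" by simp
qed

lemma finite_I_set: "finite A \<Longrightarrow> finite (I_set R A)"
proof -
  have "I_set R A \<subseteq> (\<lambda>(a, b, c, d, e, f). a \<otimes>\<^bsub>R\<^esub> (b \<ominus>\<^bsub>R\<^esub> c) \<oplus>\<^bsub>R\<^esub> d \<otimes>\<^bsub>R\<^esub> (e \<ominus>\<^bsub>R\<^esub> f))
      ` (A \<times> A \<times> A \<times> A \<times> A \<times> A)"
  proof
    fix u assume "u \<in> I_set R A"
    then obtain a b c d e f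
      where mem: "a \<in> A" "b \<in> A" "c \<in> A" "d \<in> A" "e \<in> A" "f \<in> A"
        and u: "u = a \<otimes>\<^bsub>R\<^esub> (b \<ominus>\<^bsub>R\<^esub> c) \<oplus>\<^bsub>R\<^esub> d \<otimes>\<^bsub>R\<^esub> (e \<ominus>\<^bsub>R\<^esub> f)"
      unfolding I_set_def by blast
    show "u \<in> (\<lambda>(a, b, c, d, e, f). a \<otimes>\<^bsub>R\<^esub> (b \<ominus>\<^bsub>R\<^esub> c) \<oplus>\<^bsub>R\<^esub> d \<otimes>\<^bsub>R\<^esub> (e \<ominus>\<^bsub>R\<^esub> f))
        ` (A \<times> A \<times> A \<times> A \<times> A \<times> A)"
      by (rule image_eqI[of _ _ "(a, b, c, d, e, f)"]) (use mem u in simp_all)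
  qed
  then show "finite A \<Longrightarrow> finite (I_set R A)"
    by (rule finite_subset) simp
qed

context field
begin

lemma collision_diff:
  assumes "\<xi> \<in> carrier R" "a \<in> carrier R" "b \<in> carrier R" "c \<in> carrier R" "d \<in> carrier R"
    and eq: "a \<oplus> \<xi> \<otimes> b = c \<oplus> \<xi> \<otimes> d"
  shows "\<xi> \<otimes> (b \<ominus> d) = c \<ominus> a"
proof -
  have "\<xi> \<otimes> (b \<ominus> d) = (a \<oplus> \<xi> \<otimes> b) \<ominus> a \<ominus> \<xi> \<otimes> d"
    using assms(1-5) by (simp add: minus_eq r_distr r_minus minus_add a_ac r_neg1 r_neg2)
  also have "\<dots> = c \<ominus> a"
    unfolding eq using assms(1-5) by (simp add: minus_eq a_ac r_neg r_neg1 r_neg2)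
  finally show ?thesis .
qed

text \<open>A collision with b \<noteq> d would exhibit \<xi> as the quotient (c - a) / (b - d).
  Hence b = d, and a = c follows by cancellation.\<close>

lemma inj_on_dilate_sum:
  assumes "A \<subseteq> carrier R" "\<xi> \<in> carrier R" "\<xi> \<notin> ratio_set R A"
  shows "inj_on (\<lambda>(a, b). a \<oplus> \<xi> \<otimes> b) (A \<times> A)"
proof (rule inj_onI, clarify)
  fix a b c d
  assume mem: "a \<in> A" "b \<in> A" "c \<in> A" "d \<in> A" and eq: "a \<oplus> \<xi> \<otimes> b = c \<oplus> \<xi> \<otimes> d"
  then have car: "a \<in> carrier R" "b \<in> carrier R" "c \<in> carrier R" "d \<in> carrier R"
    using assms by auto
  have "\<xi> \<otimes> (b \<ominus> d) = c \<ominus> a" using collision_diff assms(2) car eq by blast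
  then have "b = d" using mem assms(2,3) unfolding ratio_set_def by blast
  then show "a = c \<and> b = d" using eq car assms(2) by simp
qed

text \<open>For \<xi> = (a - b) / (c - d), the identity (x + \<xi>y)(c - d) = x(c - d) + y(a - b)
  has a right-hand side of the shape defining \<open>I_set\<close>, and multiplication by c - d is
  injective.\<close>

lemma card_dilate_sum_le_card_I_set:
  assumes "A \<subseteq> carrier R" "finite A" "\<xi> \<in> ratio_set R A"
  shows "card (dilate_sum R \<xi> A) \<le> card (I_set R A)"
proof -
  obtain a b c d where mem: "a \<in> A" "b \<in> A" "c \<in> A" "d \<in> A" and "c \<noteq> d"
    and \<xi>: "\<xi> \<in> carrier R" "\<xi> \<otimes> (c \<ominus> d) = a \<ominus> b"
    using assms by (auto simp: ratio_set_def)
  have car: "a \<in> carrier R" "b \<in> carrier R" "c \<in> carrier R" "d \<in> carrier R"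
    using mem assms by auto
  define e where "e = c \<ominus> d"
  have e: "e \<in> carrier R" "e \<noteq> \<zero>"
    using car \<open>c \<noteq> d\<close> by (auto simp: e_def)
  have "inj_on (\<lambda>u. u \<otimes> e) (dilate_sum R \<xi> A)"
    by (rule inj_onI) (use assms \<xi> e in \<open>auto simp: dilate_sum_def subset_iff m_rcancel\<close>)
  moreover have "(\<lambda>u. u \<otimes> e) ` dilate_sum R \<xi> A \<subseteq> I_set R A"
  proof clarsimp
    fix u assume "u \<in> dilate_sum R \<xi> A"
    then obtain x y where xy: "x \<in> A" "y \<in> A" "u = x \<oplus> \<xi> \<otimes> y"
      by (auto simp: dilate_sum_def)
    then have car': "x \<in> carrier R" "y \<in> carrier R" using assms by auto
    have "u \<otimes> e = x \<otimes> e \<oplus> y \<otimes> (\<xi> \<otimes> e)"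
      unfolding xy(3) using car' e \<xi>(1) by (simp add: l_distr r_distr m_ac)
    also have "\<dots> = x \<otimes> (c \<ominus> d) \<oplus> y \<otimes> (a \<ominus> b)"
      using \<xi>(2) by (simp add: e_def)
    finally show "u \<otimes> e \<in> I_set R A"
      unfolding I_set_def using xy mem by blast
  qed
  ultimately show ?thesis
    by (metis assms(2) card_image card_mono finite_I_set)
qed

text \<open>Averaging over \<open>\<xi>\<close>: two distinct pairs collide for at most one \<open>\<xi>\<close>.\<close>

lemma exists_large_dilate_sum:
  assumes fin: "finite (carrier R)" and A: "A \<subseteq> carrier R"
    and small: "(card A)\<^sup>2 \<le> card (carrier R)"
  obtains \<xi> where "\<xi> \<in> carrier R" "(card A)\<^sup>2 \<le> 2 * card (dilate_sum R \<xi> A)"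
proof -
  define P where "P = A \<times> A"
  define f where "f = (\<lambda>\<xi> (a, b). a \<oplus> \<xi> \<otimes> b)"
  define E where "E = (\<lambda>\<xi>. card {(x, y) \<in> P \<times> P. f \<xi> x = f \<xi> y})"
  have finP: "finite P" using fin A finite_subset by (auto simp: P_def)
  have cardP: "card P = (card A)\<^sup>2" by (simp add: P_def power2_eq_square card_cartesian_product)
  have few: "card {\<xi> \<in> carrier R. f \<xi> x = f \<xi> y} \<le> 1" if xy: "x \<in> P" "y \<in> P" "x \<noteq> y" for x y
  proof -
    obtain a b c d where ab: "x = (a, b)" "y = (c, d)" by fastforce
    have car: "a \<in> carrier R" "b \<in> carrier R" "c \<in> carrier R" "d \<in> carrier R"
      using xy A by (auto simp: P_def ab)
    have "\<xi> = \<eta>" if *: "\<xi> \<in> carrier R" "f \<xi> x = f \<xi> y" "\<eta> \<in> carrier R" "f \<eta> x = f \<eta> y" for \<xi> \<eta>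
    proof -
      have e: "\<xi> \<otimes> (b \<ominus> d) = c \<ominus> a" "\<eta> \<otimes> (b \<ominus> d) = c \<ominus> a"
        using * car by (auto simp: f_def ab intro!: collision_diff)
      have "b \<noteq> d"
      proof
        assume "b = d"
        then have "a = c" using * car by (simp add: f_def ab)
        with \<open>b = d\<close> show False using xy(3) ab by simp
      qed
      then have "b \<ominus> d \<noteq> \<zero>" using car by simp
      with e show ?thesis using * car by (metis m_rcancel minus_closed)
    qed
    then show ?thesis using fin by (simp add: card_le_Suc0_iff_eq)
  qed
  have "(\<Sum>\<xi>\<in>carrier R. E \<xi>) = (\<Sum>\<xi>\<in>carrier R. \<Sum>z\<in>P \<times> P. if f \<xi> (fst z) = f \<xi> (snd z) then 1 else 0)"
    unfolding E_def using finP
    by (intro sum.cong refl) (auto simp: sum.If_cases intro!: arg_cong[of _ _ card])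
  also have "\<dots> = (\<Sum>z\<in>P \<times> P. card {\<xi> \<in> carrier R. f \<xi> (fst z) = f \<xi> (snd z)})"
    using fin by (subst sum.swap) (simp add: sum.If_cases Int_def)
  \<comment> \<open>A diagonal pair collides for every \<xi>, any other pair for at most
    one.\<close>
  also have "\<dots> \<le> (\<Sum>z\<in>P \<times> P. 1 + (if fst z = snd z then card (carrier R) else 0))"
    using few fin by (intro sum_mono) (auto intro: card_mono le_SucI)
  also have "\<dots> = card P * card P + card {z \<in> P \<times> P. fst z = snd z} * card (carrier R)"
    using finP by (simp only: sum.distrib sum.If_cases finite_cartesian_product)
      (simp add: card_cartesian_product Int_def)
  also have "{z \<in> P \<times> P. fst z = snd z} = (\<lambda>x. (x, x)) ` P"
    by auto
  also have "card \<dots> = card P"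
    by (rule card_image) (auto intro: inj_onI)
  finally have "(\<Sum>\<xi>\<in>carrier R. E \<xi>) \<le> card P * card P + card P * card (carrier R)" .
  \<comment> \<open>Here |P| = |A|^2 \<le> |F| enters: the off-diagonal term is at most the diagonal
    one, so some \<xi> has at most 2 |P| collisions.\<close>
  also have "\<dots> \<le> (\<Sum>\<xi>\<in>carrier R. 2 * card P)"
    using mult_left_mono[OF small, of "card P"] cardP by (simp add: algebra_simps)
  finally have "\<exists>\<xi>\<in>carrier R. E \<xi> \<le> 2 * card P"
    using sum_strict_mono[OF fin, of "\<lambda>_. 2 * card P" E] by (metis carrier_not_empty not_le)
  then obtain \<xi> where \<xi>: "\<xi> \<in> carrier R" "E \<xi> \<le> 2 * card P" by blast
  have "(card P)\<^sup>2 \<le> card (f \<xi> ` P) * E \<xi>"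
    unfolding E_def by (rule card_squared_le_card_image_mult_collisions[OF finP])
  also have "\<dots> \<le> card (f \<xi> ` P) * (2 * card P)"
    using \<xi> by simp
  finally have "card P * card P \<le> (2 * card (f \<xi> ` P)) * card P"
    by (simp add: power2_eq_square ac_simps)
  then have "card P \<le> 2 * card (f \<xi> ` P)" by auto
  then have "(card A)\<^sup>2 \<le> 2 * card (dilate_sum R \<xi> A)"
    unfolding cardP by (simp add: dilate_sum_def f_def P_def)
  then show ?thesis using that \<xi>(1) by blast
qed

lemma card_le_card_difference_set:
  assumes "A \<subseteq> carrier R" "finite A"
  shows "card A \<le> card (difference_set R A)"
proof (cases "A = {}")
  case False
  then obtain a where a: "a \<in> A" by blast
  have "inj_on (\<lambda>x. x \<ominus> a) A"
    using assms a by (auto intro!: inj_onI simp: minus_eq subset_iff)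
  moreover have "(\<lambda>x. x \<ominus> a) ` A \<subseteq> difference_set R A"
    using a by (auto simp: difference_set_def)
  ultimately show ?thesis
    by (metis assms(2) card_image card_mono finite_difference_set)
qed simp

lemma power5_card_le_of_ratio_set_gap:
  assumes A: "A \<subseteq> carrier R" "finite A" "A \<noteq> {}"
    and in_ratio: "\<xi> \<in> ratio_set R A" and gap: "\<xi> \<ominus> \<one> \<notin> ratio_set R A"
  shows "card A ^ 5 \<le> (card (difference_set R A) * card (I_set R A))\<^sup>2"
proof -
  define B where "B = (\<lambda>a. \<xi> \<otimes> a) ` A"
  define C where "C = (\<lambda>a. \<ominus> a) ` A"
  have \<xi>: "\<xi> \<in> carrier R" using in_ratio by (simp add: ratio_set_def)
  have BC: "finite B" "B \<subseteq> carrier R" "finite C" "C \<subseteq> carrier R"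
    using A \<xi> by (auto simp: B_def C_def)
  \<comment> \<open>The multiplicative result is used in the additive group, with B = \<xi>A and
    later C = -A.\<close>
  obtain X where X: "X \<subseteq> A" "X \<noteq> {}"
    and XB: "card (X <#>\<^bsub>add_monoid R\<^esub> B) * card A \<le> card (A <#>\<^bsub>add_monoid R\<^esub> B) * card X"
    and XBC: "\<And>C. \<lbrakk>finite C; C \<subseteq> carrier R\<rbrakk> \<Longrightarrow>
      card (X <#>\<^bsub>add_monoid R\<^esub> B <#>\<^bsub>add_monoid R\<^esub> C) * card A
      \<le> card (A <#>\<^bsub>add_monoid R\<^esub> B) * card (X <#>\<^bsub>add_monoid R\<^esub> C)"
    by (rule add.pluennecke_subset[OF A(2,3,1) BC(1,2)]) (erule (2) that, blast)
  have finX: "finite X" using X A finite_subset by blast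
  have Xc: "X \<subseteq> carrier R" using X A by blast
  have "A <#>\<^bsub>add_monoid R\<^esub> B = dilate_sum R \<xi> A"
    by (auto simp: set_mult_def dilate_sum_def B_def)
  then have AB: "card (A <#>\<^bsub>add_monoid R\<^esub> B) \<le> card (I_set R A)"
    using card_dilate_sum_le_card_I_set A in_ratio by simp
  have "X <#>\<^bsub>add_monoid R\<^esub> C \<subseteq> difference_set R A"
    using X by (auto simp: set_mult_def difference_set_def C_def minus_eq)
  then have XC: "card (X <#>\<^bsub>add_monoid R\<^esub> C) \<le> card (difference_set R A)"
    using card_mono finite_difference_set A(2) by blast
  \<comment> \<open>Otherwise \<xi> - 1 = -1 = (d - c) / (c - d) would be a quotient of
    differences.\<close>
  have "\<xi> \<noteq> \<zero>"
  proof
    assume "\<xi> = \<zero>"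
    obtain c d where cd: "c \<in> A" "d \<in> A" "c \<noteq> d"
      using in_ratio by (auto simp: ratio_set_def)
    then have "(\<xi> \<ominus> \<one>) \<otimes> (c \<ominus> d) = d \<ominus> c"
      using A \<open>\<xi> = \<zero>\<close> by (simp add: minus_eq subset_iff l_minus minus_add a_comm)
    with cd \<xi> have "\<xi> \<ominus> \<one> \<in> ratio_set R A" by (auto simp: ratio_set_def)
    with gap show False ..
  qed
  have lower1: "card A \<le> card (X <#>\<^bsub>add_monoid R\<^esub> B)"
  proof -
    obtain x where x: "x \<in> X" using X by blast
    have "inj_on (\<lambda>a. x \<oplus> \<xi> \<otimes> a) A"
      using x Xc A \<xi> \<open>\<xi> \<noteq> \<zero>\<close> by (auto intro!: inj_onI simp: subset_iff m_lcancel)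
    moreover have "(\<lambda>a. x \<oplus> \<xi> \<otimes> a) ` A \<subseteq> X <#>\<^bsub>add_monoid R\<^esub> B"
      using x by (auto simp: set_mult_def B_def)
    ultimately show ?thesis
      by (metis add.finite_set_mult BC(1) card_image card_mono finX)
  qed
  have lower2: "card X * card A \<le> card (X <#>\<^bsub>add_monoid R\<^esub> B <#>\<^bsub>add_monoid R\<^esub> C)"
  proof -
    let ?g = "\<lambda>(a, b). a \<oplus> (\<xi> \<ominus> \<one>) \<otimes> b"
    have "inj_on ?g (A \<times> A)"
      using inj_on_dilate_sum[OF A(1) _ gap] \<xi> by simp
    then have "inj_on ?g (X \<times> A)"
      by (rule inj_on_subset) (use X in auto)
    \<comment> \<open>Expanding (\<xi> - 1)a as \<xi>a - a puts the same a into both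
      \<open>B\<close> and \<open>C\<close>.\<close>
    moreover have "?g ` (X \<times> A) \<subseteq> X <#>\<^bsub>add_monoid R\<^esub> B <#>\<^bsub>add_monoid R\<^esub> C"
    proof clarify
      fix x a assume xa: "x \<in> X" "a \<in> A"
      then have "x \<oplus> (\<xi> \<ominus> \<one>) \<otimes> a = x \<oplus> \<xi> \<otimes> a \<oplus> \<ominus> a"
        using Xc A \<xi> by (simp add: minus_eq subset_iff l_distr l_minus a_assoc)
      then show "x \<oplus> (\<xi> \<ominus> \<one>) \<otimes> a \<in> X <#>\<^bsub>add_monoid R\<^esub> B <#>\<^bsub>add_monoid R\<^esub> C"
        using xa by (auto simp: set_mult_def B_def C_def)
    qed
    ultimately show ?thesis
      by (metis add.finite_set_mult BC(1,3) card_image card_mono finX card_cartesian_product)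
  qed
  define n k d i where "n = card A" and "k = card X"
    and "d = card (difference_set R A)" and "i = card (I_set R A)"
  have "k > 0" using X finX by (simp add: k_def card_gt_0_iff)
  have "n \<le> d" using card_le_card_difference_set A by (simp add: n_def d_def)
  have "k * n * n \<le> card (X <#>\<^bsub>add_monoid R\<^esub> B <#>\<^bsub>add_monoid R\<^esub> C) * n"
    using lower2 by (simp add: k_def n_def)
  also have "\<dots> \<le> i * d"
    using XBC[OF BC(3,4)] mult_mono[OF AB XC] unfolding n_def d_def i_def by linarith
  finally have 1: "k * n * n \<le> i * d" .
  have "n * n \<le> card (X <#>\<^bsub>add_monoid R\<^esub> B) * n"
    using lower1 by (simp add: n_def)
  also have "\<dots> \<le> i * k"
    using XB mult_right_mono[OF AB, of k] unfolding n_def k_def i_def by linarith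
  finally have "n * n * n \<le> i * k * d"
    using \<open>n \<le> d\<close> by (rule mult_mono) auto
  \<comment> \<open>Both bounds are linear in k on opposite sides, so k cancels from the product,
    leaving n^5 against (d i)^2.\<close>
  with 1 have "(k * n * n) * (n * n * n) \<le> (i * d) * (i * k * d)"
    by (rule mult_mono) auto
  then have "k * n ^ 5 \<le> k * (d * i)\<^sup>2"
    by (simp add: eval_nat_numeral ac_simps)
  with \<open>k > 0\<close> show ?thesis by (simp add: n_def d_def i_def)
qed

end

section \<open>The dichotomy over a prime field\<close>

context residues_prime
begin

text \<open>Starting at 0 and subtracting 1 repeatedly reaches every residue, since x is congruent
  to -(p - x). In a non-prime finite field the prime subfield would be a counterexample.\<close>

lemma closed_under_pred_imp_carrier:
  assumes S: "S \<subseteq> carrier R" "\<zero> \<in> S" and closed: "\<And>x. x \<in> S \<Longrightarrow> x \<ominus> \<one> \<in> S"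
  shows "S = carrier R"
proof -
  have neg: "(- int k) mod int p \<in> S" for k
  proof (induction k)
    case 0
    then show ?case using S(2) by (simp add: res_zero_eq)
  next
    case (Suc k)
    have "(- int k) mod int p \<ominus> \<one> = (- int (Suc k)) mod int p"
      by (simp add: minus_eq res_neg_eq res_add_eq res_one_eq mod_simps algebra_simps)
    with closed[OF Suc] show ?case by simp
  qed
  have "x \<in> S" if "x \<in> carrier R" for x
  proof -
    have "x = (- int (nat (int p - x))) mod int p"
      using that by (simp add: res_carrier_eq)
    then show ?thesis using neg by metis
  qed
  with S(1) show ?thesis by blast
qed

text \<open>The inequality is squared to stay within the natural numbers. The factor 4 is the square
  of the 2 lost in averaging; it arises only when every field element is a quotient of
  differences.\<close>

lemma power5_card_le:
  assumes A: "A \<subseteq> carrier R" "A \<noteq> {}" and small: "(card A)\<^sup>2 \<le> card (carrier R)"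
  shows "card A ^ 5 \<le> 4 * (card (difference_set R A) * card (I_set R A))\<^sup>2"
proof -
  define n d i where "n = card A"
    and "d = card (difference_set R A)" and "i = card (I_set R A)"
  have fin: "finite A" using A finite_subset by blast
  have "n \<le> d" using card_le_card_difference_set A fin by (simp add: n_def d_def)
  have "n > 0" using A fin by (simp add: n_def card_gt_0_iff)
  have "n ^ 5 \<le> 4 * (d * i)\<^sup>2"
  proof (cases "ratio_set R A = carrier R")
    case True
    obtain \<xi> where "\<xi> \<in> carrier R" "n\<^sup>2 \<le> 2 * card (dilate_sum R \<xi> A)"
      using exists_large_dilate_sum[OF finite A(1) small] by (auto simp: n_def)
    then have "n\<^sup>2 \<le> 2 * i"
      using card_dilate_sum_le_card_I_set[OF A(1) fin] True by (fastforce simp: i_def)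
    \<comment> \<open>The fifth factor n is absorbed by n \<le> d \<le> d^2.\<close>
    then have "(n\<^sup>2)\<^sup>2 * n \<le> (2 * i)\<^sup>2 * d\<^sup>2"
      using \<open>n \<le> d\<close> by (intro mult_mono power_mono) (auto simp: power2_eq_square intro: order_trans)
    moreover have "(n\<^sup>2)\<^sup>2 * n = n ^ 5" by (simp add: eval_nat_numeral)
    ultimately show ?thesis by (simp add: power_mult_distrib ac_simps)
  next
    case False
    show ?thesis
    \<comment> \<open>A singleton has no nonzero difference, so its ratio set is empty and offers no
      starting point for the descent from 0; here the bound only needs d i > 0.\<close>
    proof (cases "n = 1")
      case True
      obtain a where "a \<in> A" using A by blast
      then have "a \<otimes> (a \<ominus> a) \<oplus> a \<otimes> (a \<ominus> a) \<in> I_set R A"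
        unfolding I_set_def by blast
      then have "i > 0" using fin finite_I_set by (auto simp: i_def card_gt_0_iff)
      with \<open>n \<le> d\<close> True have "d * i > 0" by simp
      then show ?thesis using True by (simp add: Suc_le_eq)
    next
      case False
      then obtain a b where ab: "a \<in> A" "b \<in> A" "a \<noteq> b"
        using A(2) unfolding n_def by (metis card_1_singleton_iff is_singletonI' is_singleton_altdef)
      then have "\<zero> \<otimes> (a \<ominus> b) = a \<ominus> a" using A by (auto simp: subset_iff minus_eq r_neg)
      with ab have "\<zero> \<in> ratio_set R A" unfolding ratio_set_def by blast
      moreover have "ratio_set R A \<subseteq> carrier R" by (auto simp: ratio_set_def)
      \<comment> \<open>Without such a \<xi>, the ratio set would contain 0 and be closed under
        subtracting 1, hence be the whole field.\<close>
      ultimately obtain \<xi> where "\<xi> \<in> ratio_set R A" "\<xi> \<ominus> \<one> \<notin> ratio_set R A"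
        using closed_under_pred_imp_carrier \<open>ratio_set R A \<noteq> carrier R\<close> by blast
      from power5_card_le_of_ratio_set_gap[OF A(1) fin A(2) this]
      have "n ^ 5 \<le> (d * i)\<^sup>2" by (simp add: n_def d_def i_def)
      then show ?thesis by linarith
    qed
  qed
  then show ?thesis by (simp add: n_def d_def i_def)
qed

end

section \<open>Passage to real exponents\<close>

theorem theorem2:
  shows "\<exists>c::real. c > 0 \<and>
    (\<forall>(q::nat) (F::int ring) (A::int set).
      prime q \<longrightarrow> F = residue_ring (int q) \<longrightarrow>
      A \<subseteq> carrier F \<longrightarrow> A \<noteq> {} \<longrightarrow>
      real (card A) < real (card (carrier F)) powr (1/2) \<longrightarrow>
      real (card (difference_set F A)) * real (card (I_set F A))
        \<ge> c * real (card A) powr (5/2))"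
\<comment> \<open>The constant 1/2 is what the factor 4 becomes after taking square roots.\<close>
proof (intro exI[of _ "1/2"] conjI allI impI)
  fix q :: nat and F :: "int ring" and A :: "int set"
  assume q: "prime q" and F: "F = residue_ring (int q)" and A: "A \<subseteq> carrier F" "A \<noteq> {}"
    and small: "real (card A) < real (card (carrier F)) powr (1/2)"
  interpret residues_prime q F
    by (rule residues_prime.intro) (use q F in auto)
  have "real (card A) ^ 2 \<le> sqrt (card (carrier F)) ^ 2"
    using small by (intro power_mono) (auto simp: powr_half_sqrt)
  then have "(card A)\<^sup>2 \<le> card (carrier F)"
    by (simp flip: of_nat_power)
  from power5_card_le[OF A this]
  have "real (card A ^ 5) \<le> real (4 * (card (difference_set F A) * card (I_set F A))\<^sup>2)"
    by (simp only: of_nat_le_iff)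
  then have le: "real (card A) ^ 5
      \<le> (2 * (real (card (difference_set F A)) * real (card (I_set F A))))\<^sup>2"
    by (simp add: power_mult_distrib)
  have "card A > 0" using A finite_subset[OF A(1)] by (simp add: card_gt_0_iff)
  then have "real (card A) powr (5/2) = (real (card A) powr 5) powr (1/2)"
    by (simp only: powr_powr) simp
  also have "\<dots> = sqrt (real (card A) ^ 5)"
    using \<open>card A > 0\<close> by (simp add: powr_half_sqrt powr_numeral)
  also have "\<dots> \<le> 2 * (real (card (difference_set F A)) * real (card (I_set F A)))"
    by (rule real_le_lsqrt[OF _ le]) simp
  finally show "1/2 * real (card A) powr (5/2)
      \<le> real (card (difference_set F A)) * real (card (I_set F A))"
    by simp
qed simp

end
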